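(* Fundamental circle complexes are governed by the real symmetric $M$-system. That is: (i) Let $\mathcal M=(M^{ik})_{i,k=1,\dots,5}:\mathbb Z^3\to\mathbb R^{5\times5}$ be a (generic) solution of the $M$-system $$M^{ik}_l=M^{ik}-\frac{M^{il}M^{lk}}{M^{ll}},\qquad l\in\{1,2,3\}\setminus\{i,k\},$$ which is real and symmetric, $\mathcal M^T=\mathcal M$. Then the lines with Plücker coordinates $$(\gamma^{01},\gamma^{23},\gamma^{02},\gamma^{13},\gamma^{03},\gamma^{12})=\bigl(1,\;M^{44}M^{55}-M^{45}M^{54},\;M^{44},\;M^{55},\;M^{54},\;M^{45}\bigr)$$ belong to the linear line complex $\mathcal L$ given by $\gamma^{03}=\gamma^{12}$ and, regarded as oriented circles, form a fundamental circle complex. (ii) Conversely, every (generic) fundamental circle complex arises in this manner from a real symmetric solution $\mathcal M$ of the $M$-system.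
   Context: Notation: for a function $f$ on $\mathbb Z^3$, a lower index $l\in\{1,2,3\}$ denotes the unit shift $n_l\mapsto n_l+1$; several lower indices denote the composed shifts. Upper indices are labels. Line complexes: a line complex is a map $\mathsf l:\mathbb Z^3\to\{\text{lines in }\mathbb{RP}^3\}$. It is fundamental if any neighbouring lines $\mathsf l,\mathsf l_l$ intersect, in a point $\mathsf p^l=\mathsf l\cap\mathsf l_l$, and for any distinct $l,m,p\in\{1,2,3\}$ (at every lattice site) the four points $\mathsf p^l,\mathsf p^l_m,\mathsf p^l_{mp},\mathsf p^l_p$ are coplanar. Plücker coordinates: the line through two distinct points with homogeneous coordinates $(\alpha^0,\dots,\alpha^3)$, $(\beta^0,\dots,\beta^3)$ has Plücker coordinates $\gamma^{\mu\nu}=\alpha^\mu\beta^\nu-\alpha^\nu\beta^\mu$, which satisfy $\gamma^{01}\gamma^{23}-\gamma^{02}\gamma^{13}+\gamma^{03}\gamma^{12}=0$. Let $\mathcal L$ be the linear line complex $\{\gamma^{03}=\gamma^{12}\}$. Via $(\gamma^{01},\gamma^{23},\gamma^{02},\gamma^{13},\gamma^{03})$ it is identified with the real quadric $2\gamma^{01}\gamma^{23}-2\gamma^{02}\gamma^{13}+2(\gamma^{03})^2=0$ of signature $(3,2)$. Circles: on $\mathbb R^5$ put $\langle V,V'\rangle=xx'+yy'-\tfrac12(ab'+a'b)-rr'$ for $V=(x,y,a,b,r)$. The points of the Lie quadric $\{[V]\in\mathbb{RP}^4:\langle V,V\rangle=0\}$ are the oriented circles of $\mathbb R^2$ in the sense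 of Lie geometry: $(x,y,1,x^2+y^2-r^2,r)$ is the oriented circle with centre $(x,y)$ and signed radius $r$ (a point if $r=0$), $(v,w,0,2d,1)$ with $v^2+w^2=1$ is an oriented line, and $(0,0,0,1,0)$ is the point at infinity. Two of them are in oriented contact (touch) iff $\langle V,V'\rangle=0$. A linear isometry between the two quadratic spaces of signature $(3,2)$ is fixed, so that lines of $\mathcal L$ are identified with oriented circles; two lines of $\mathcal L$ intersect iff the corresponding circles are in oriented contact. A circle complex $\mathsf c:\mathbb Z^3\to\{\text{oriented circles in }\mathbb R^2\}$ is fundamental if the circles, interpreted as lines of $\mathcal L$, form a fundamental line complex. Genericity: a fundamental line complex in $\mathbb{RP}^3$ is called generic here if it is parametrised, through the formula $(\gamma^{01},\gamma^{23},\gamma^{02},\gamma^{13},\gamma^{03},\gamma^{12})=(1,M^{44}M^{55}-M^{45}M^{54},M^{44},M^{55},M^{54},M^{45})$ for the Plücker coordinates of its lines, by a real (not necessarily symmetric) solution $\mathcal M:\mathbb Z^3\to\mathbb R^{5\times5}$ of the $M$-system $M^{ik}_l=M^{ik}-M^{il}M^{lk}/M^{ll}$, $l\in\{1,2,3\}\setminus\{i,k\}$, with all $M^{ll}\ne0$, $l=1,2,3$ (it is known that all fundamental line complexes in general position are of this form), neighbouring lines are distinct, and the points $\mathsf p^1,\mathsf p^2,\mathsf p^3$ on each line are pairwise distinct. A solution $\mathcal M$ is generic if $M^{ll}\neq 0$ and the resulting lines satisfy the latter two conditions. A fundamental circle complex is generic if its line complex is. *)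

theory Defs
  imports "HOL-Analysis.Analysis"
begin

text \<open>
  A subspace of \<open>real^4\<close> of dimension \<open>k + 1\<close> stands for a \<open>k\<close>-dimensional projective
  subspace of real projective 3-space; homogeneous coordinates are numbered 0, 1, 2, 3.
\<close>

definition proj_points :: "(real^4) set set" where
  "proj_points = {p. subspace p \<and> dim p = 1}"

definition proj_lines :: "(real^4) set set" where
  "proj_lines = {l. subspace l \<and> dim l = 2}"

definition coplanar_points :: "(real^4) set set \<Rightarrow> bool" where
  "coplanar_points P \<longleftrightarrow> (\<exists>E. subspace E \<and> dim E = 3 \<and> (\<forall>p\<in>P. p \<subseteq> E))"


text \<open>The index type \<open>3\<close> numbers the three lattice directions (where \<open>0 = 3\<close>).\<close>

definition shift :: "3 \<Rightarrow> int^3 \<Rightarrow> int^3" where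
  "shift l n = n + axis l 1"

text \<open>
  The intersection of neighbouring lines, as a subspace; it is a point exactly if the lines
  are distinct and intersect.
\<close>

definition focal_point :: "(int^3 \<Rightarrow> (real^4) set) \<Rightarrow> 3 \<Rightarrow> int^3 \<Rightarrow> (real^4) set" where
  "focal_point L l n = L n \<inter> L (shift l n)"

definition fundamental_line_complex :: "(int^3 \<Rightarrow> (real^4) set) \<Rightarrow> bool" where
  "fundamental_line_complex L \<longleftrightarrow>
     (\<forall>n. L n \<in> proj_lines) \<and>
     (\<forall>n l. focal_point L l n \<in> proj_points) \<and>
     (\<forall>n l m p. distinct [l, m, p] \<longrightarrow>
        coplanar_points {focal_point L l n, focal_point L l (shift m n),
          focal_point L l (shift p (shift m n)), focal_point L l (shift p n)})"


text \<open>Pluecker coordinates are listed in the order 01, 23, 02, 13, 03, 12.\<close>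

type_synonym coords6 = "real \<times> real \<times> real \<times> real \<times> real \<times> real"

definition pluecker :: "real^4 \<Rightarrow> real^4 \<Rightarrow> coords6" where
  "pluecker \<alpha> \<beta> =
     (let \<gamma> = (\<lambda>\<mu> \<nu>. \<alpha>$\<mu> * \<beta>$\<nu> - \<alpha>$\<nu> * \<beta>$\<mu>)
      in (\<gamma> 0 1, \<gamma> 2 3, \<gamma> 0 2, \<gamma> 1 3, \<gamma> 0 3, \<gamma> 1 2))"

text \<open>
  The coordinates are homogeneous: rescaling \<open>\<alpha>\<close> rescales \<open>g\<close>, so that every nonzero
  multiple of a coordinate vector of \<open>l\<close> is also one.
\<close>

definition has_pluecker :: "(real^4) set \<Rightarrow> coords6 \<Rightarrow> bool" where
  "has_pluecker l g \<longleftrightarrow> l \<in> proj_lines \<and> (\<exists>\<alpha> \<beta>. l = span {\<alpha>, \<beta>} \<and> g = pluecker \<alpha> \<beta>)"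

definition line_of_coords :: "coords6 \<Rightarrow> (real^4) set" where
  "line_of_coords g = (THE l. has_pluecker l g)"

definition linear_complex :: "(real^4) set set" where
  "linear_complex = {l. \<exists>g01 g23 g02 g13 g03 g12.
     has_pluecker l (g01, g23, g02, g13, g03, g12) \<and> g03 = g12}"


type_synonym real5 = "real \<times> real \<times> real \<times> real \<times> real"

text \<open>The symmetric bilinear form of \<open>2 g01 g23 - 2 g02 g13 + 2 g03\<^sup>2\<close>.\<close>

fun complex_form :: "real5 \<Rightarrow> real5 \<Rightarrow> real" where
  "complex_form (g01, g23, g02, g13, g03) (h01, h23, h02, h13, h03) =
     g01 * h23 + g23 * h01 - g02 * h13 - g13 * h02 + 2 * g03 * h03"

fun lie_form :: "real5 \<Rightarrow> real5 \<Rightarrow> real" where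
  "lie_form (x, y, a, b, r) (x', y', a', b', r') =
     x * x' + y * y' - (a * b' + a' * b) / 2 - r * r'"

text \<open>Points of the Lie quadric in projective 4-space, as one-dimensional subspaces.\<close>

definition oriented_circles :: "real5 set set" where
  "oriented_circles = {C. subspace C \<and> dim C = 1 \<and> (\<forall>V\<in>C. lie_form V V = 0)}"

definition lie_isometry :: "(real5 \<Rightarrow> real5) \<Rightarrow> bool" where
  "lie_isometry T \<longleftrightarrow> linear T \<and> bij T \<and> (\<forall>g h. lie_form (T g) (T h) = complex_form g h)"

text \<open>
  The generating set consists of the nonzero multiples of a single vector, because
  Pluecker coordinates of a line are unique up to a nonzero factor.
\<close>

definition circle_of_line :: "(real5 \<Rightarrow> real5) \<Rightarrow> (real^4) set \<Rightarrow> real5 set" where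
  "circle_of_line T l = span {T (g01, g23, g02, g13, g03) | g01 g23 g02 g13 g03.
     has_pluecker l (g01, g23, g02, g13, g03, g03)}"

definition line_of_circle :: "(real5 \<Rightarrow> real5) \<Rightarrow> real5 set \<Rightarrow> (real^4) set" where
  "line_of_circle T = the_inv_into linear_complex (circle_of_line T)"

definition fundamental_circle_complex ::
    "(real5 \<Rightarrow> real5) \<Rightarrow> (int^3 \<Rightarrow> real5 set) \<Rightarrow> bool" where
  "fundamental_circle_complex T c \<longleftrightarrow>
     (\<forall>n. c n \<in> oriented_circles) \<and> fundamental_line_complex (\<lambda>n. line_of_circle T (c n))"


text \<open>The lattice directions 1, 2, 3 as matrix indices in 1, ..., 5.\<close>

definition dir :: "3 \<Rightarrow> 5" where
  "dir l = (if l = 1 then 1 else if l = 2 then 2 else 3)"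

text \<open>
  Where a diagonal entry vanishes the quotient is \<open>0\<close> by convention; solutions are only
  considered together with \<open>nonzero_pivots\<close> below.
\<close>

definition M_system :: "(int^3 \<Rightarrow> real^5^5) \<Rightarrow> bool" where
  "M_system M \<longleftrightarrow> (\<forall>n l i k. dir l \<notin> {i, k} \<longrightarrow>
     M (shift l n) $ i $ k =
       M n $ i $ k - M n $ i $ dir l * M n $ dir l $ k / M n $ dir l $ dir l)"

definition nonzero_pivots :: "(int^3 \<Rightarrow> real^5^5) \<Rightarrow> bool" where
  "nonzero_pivots M \<longleftrightarrow> (\<forall>n l. M n $ dir l $ dir l \<noteq> 0)"

definition M_coords :: "real^5^5 \<Rightarrow> coords6" where
  "M_coords A = (1, A$4$4 * A$5$5 - A$4$5 * A$5$4, A$4$4, A$5$5, A$5$4, A$4$5)"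

definition M_lines :: "(int^3 \<Rightarrow> real^5^5) \<Rightarrow> int^3 \<Rightarrow> (real^4) set" where
  "M_lines M n = line_of_coords (M_coords (M n))"

definition nondegenerate :: "(int^3 \<Rightarrow> (real^4) set) \<Rightarrow> bool" where
  "nondegenerate L \<longleftrightarrow>
     (\<forall>n l. L n \<noteq> L (shift l n)) \<and>
     (\<forall>n l m. l \<noteq> m \<longrightarrow> focal_point L l n \<noteq> focal_point L m n)"

definition generic_solution :: "(int^3 \<Rightarrow> real^5^5) \<Rightarrow> bool" where
  "generic_solution M \<longleftrightarrow> M_system M \<and> nonzero_pivots M \<and> nondegenerate (M_lines M)"

definition generic_line_complex :: "(int^3 \<Rightarrow> (real^4) set) \<Rightarrow> bool" where
  "generic_line_complex L \<longleftrightarrow>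
     (\<exists>M. M_system M \<and> nonzero_pivots M \<and> (\<forall>n. has_pluecker (L n) (M_coords (M n)))) \<and>
     nondegenerate L"

definition generic_circle_complex ::
    "(real5 \<Rightarrow> real5) \<Rightarrow> (int^3 \<Rightarrow> real5 set) \<Rightarrow> bool" where
  "generic_circle_complex T c \<longleftrightarrow> generic_line_complex (\<lambda>n. line_of_circle T (c n))"


text \<open>
  The identifications used above are well defined: \<open>line_of_coords\<close> inverts the passage to
  Pluecker coordinates (\<open>line_of_coords_eq\<close>, \<open>has_M_coords\<close>), an isometry exists
  (\<open>lie_isometry_exists\<close>), and each one identifies the lines of the linear complex
  bijectively with the oriented circles (\<open>bij_circle_of_line\<close>).
\<close>

lemma vec4_eq_iff: "(x::real^4) = y \<longleftrightarrow> x$0 = y$0 \<and> x$1 = y$1 \<and> x$2 = y$2 \<and> x$3 = y$3"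
proof -
  have 4: "(4::4) = 0" by simp
  show ?thesis unfolding vec_eq_iff forall_4 4 by auto
qed

lemma dim_span_pair: "dim (span {\<alpha>, \<beta>::real^4}) = 2 \<longleftrightarrow> pluecker \<alpha> \<beta> \<noteq> 0"
proof
  assume d: "dim (span {\<alpha>, \<beta>}) = 2"
  show "pluecker \<alpha> \<beta> \<noteq> 0"
  proof
    assume 0: "pluecker \<alpha> \<beta> = 0"
    have "dim {\<alpha>, \<beta>} \<le> 1"
    proof (cases "\<alpha> = 0")
      case True
      then have "dim {\<alpha>, \<beta>} \<le> card {\<beta>}"
        by (intro dim_le_card) (auto intro: span_base span_zero)
      then show ?thesis by simp
    next
      case False
      have "\<exists>c. \<beta> = c *\<^sub>R \<alpha>"
      proof -
        from False consider "\<alpha>$0 \<noteq> 0" | "\<alpha>$1 \<noteq> 0" | "\<alpha>$2 \<noteq> 0" | "\<alpha>$3 \<noteq> 0"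
          by (auto simp: vec4_eq_iff)
        then show ?thesis
        proof cases
          case 1 show ?thesis using 1 0 by (intro exI[of _ "\<beta>$0/\<alpha>$0"]) (auto simp: vec4_eq_iff pluecker_def zero_prod_def field_simps)
        next
          case 2 show ?thesis using 2 0 by (intro exI[of _ "\<beta>$1/\<alpha>$1"]) (auto simp: vec4_eq_iff pluecker_def zero_prod_def field_simps)
        next
          case 3 show ?thesis using 3 0 by (intro exI[of _ "\<beta>$2/\<alpha>$2"]) (auto simp: vec4_eq_iff pluecker_def zero_prod_def field_simps)
        next
          case 4 show ?thesis using 4 0 by (intro exI[of _ "\<beta>$3/\<alpha>$3"]) (auto simp: vec4_eq_iff pluecker_def zero_prod_def field_simps)
        qed
      qed
      then have "dim {\<alpha>, \<beta>} \<le> card {\<alpha>}"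
        by (intro dim_le_card) (auto intro: span_base span_scale)
      then show ?thesis by simp
    qed
    with d show False by simp
  qed
next
  assume nz: "pluecker \<alpha> \<beta> \<noteq> 0"
  then have "\<beta> \<noteq> 0" "\<alpha> \<noteq> \<beta>" by (auto simp: pluecker_def zero_prod_def)
  moreover have "\<alpha> \<notin> span {\<beta>}"
    using nz by (auto simp: span_singleton pluecker_def zero_prod_def algebra_simps)
  ultimately have "independent {\<alpha>, \<beta>}" by (simp add: independent_insert)
  then show "dim (span {\<alpha>, \<beta>}) = 2"
    using \<open>\<alpha> \<noteq> \<beta>\<close> by (simp add: dim_eq_card_independent)
qed

lemma has_pluecker_iff:
  "has_pluecker l g \<longleftrightarrow> g \<noteq> 0 \<and> (\<exists>\<alpha> \<beta>. l = span {\<alpha>, \<beta>} \<and> g = pluecker \<alpha> \<beta>)"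
  unfolding has_pluecker_def proj_lines_def by (auto simp: dim_span_pair[simplified])

lemma mem_line_iff:
  assumes "has_pluecker l (g01, g23, g02, g13, g03, g12)"
  shows "x \<in> l \<longleftrightarrow>
    x$0 * g12 - x$1 * g02 + x$2 * g01 = 0 \<and> x$0 * g13 - x$1 * g03 + x$3 * g01 = 0 \<and>
    x$0 * g23 - x$2 * g03 + x$3 * g02 = 0 \<and> x$1 * g23 - x$2 * g13 + x$3 * g12 = 0" (is "_ = ?R")
proof -
  from assms obtain \<alpha> \<beta> where l: "l = span {\<alpha>, \<beta>}"
    and g: "(g01, g23, g02, g13, g03, g12) = pluecker \<alpha> \<beta>" and nz: "pluecker \<alpha> \<beta> \<noteq> 0"
    by (auto simp: has_pluecker_iff)
  have e: "g01 = \<alpha>$0 * \<beta>$1 - \<alpha>$1 * \<beta>$0" "g23 = \<alpha>$2 * \<beta>$3 - \<alpha>$3 * \<beta>$2"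
     "g02 = \<alpha>$0 * \<beta>$2 - \<alpha>$2 * \<beta>$0" "g13 = \<alpha>$1 * \<beta>$3 - \<alpha>$3 * \<beta>$1"
     "g03 = \<alpha>$0 * \<beta>$3 - \<alpha>$3 * \<beta>$0" "g12 = \<alpha>$1 * \<beta>$2 - \<alpha>$2 * \<beta>$1"
    using g by (auto simp: pluecker_def)
  have sp: "x \<in> l \<longleftrightarrow> (\<exists>s t. x = s *\<^sub>R \<alpha> + t *\<^sub>R \<beta>)"
    unfolding l span_insert span_singleton by (auto simp: algebra_simps)
  show ?thesis
  proof
    assume "x \<in> l"
    then obtain s t where x: "x = s *\<^sub>R \<alpha> + t *\<^sub>R \<beta>" using sp by auto
    show ?R unfolding x e by (simp add: algebra_simps)
  next
    assume R: ?R
    let ?w = "\<lambda>u v i j. u$i * v$j - u$j * v$i :: real"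
    have key: "x \<in> l" if "?w \<alpha> \<beta> i j \<noteq> 0"
       "\<And>k. ?w \<alpha> \<beta> i j * x$k = ?w x \<beta> i j * \<alpha>$k + ?w \<alpha> x i j * \<beta>$k" for i j
    proof -
      have "x = (?w x \<beta> i j / ?w \<alpha> \<beta> i j) *\<^sub>R \<alpha> + (?w \<alpha> x i j / ?w \<alpha> \<beta> i j) *\<^sub>R \<beta>"
        unfolding vec_eq_iff
      proof
        fix k show "x$k = ((?w x \<beta> i j / ?w \<alpha> \<beta> i j) *\<^sub>R \<alpha> + (?w \<alpha> x i j / ?w \<alpha> \<beta> i j) *\<^sub>R \<beta>) $ k"
          using that(1) that(2)[of k] by (simp add: divide_simps mult.commute)
      qed
      then show ?thesis unfolding sp by blast
    qed
    have all: "(\<forall>k. P k) \<longleftrightarrow> P 0 \<and> P 1 \<and> P 2 \<and> P (3::4)" for P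
    proof -
      have 4: "(4::4) = 0" by simp
      show ?thesis unfolding forall_4 4 by auto
    qed
    from R have r: "x$2 * g01 = x$1 * g02 - x$0 * g12" "x$3 * g01 = x$1 * g03 - x$0 * g13"
      "x$3 * g02 = x$2 * g03 - x$0 * g23" "x$3 * g12 = x$2 * g13 - x$1 * g23"
      by (auto simp: algebra_simps)
    note d = r[unfolded e ring_distribs]
    from nz consider "?w \<alpha> \<beta> 0 1 \<noteq> 0" | "?w \<alpha> \<beta> 0 2 \<noteq> 0" | "?w \<alpha> \<beta> 0 3 \<noteq> 0"
      | "?w \<alpha> \<beta> 1 2 \<noteq> 0" | "?w \<alpha> \<beta> 1 3 \<noteq> 0" | "?w \<alpha> \<beta> 2 3 \<noteq> 0"
      by (auto simp: pluecker_def zero_prod_def)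
    then show "x \<in> l"
    proof cases
      case 1
      have "\<forall>k. ?w \<alpha> \<beta> 0 1 * x$k = ?w x \<beta> 0 1 * \<alpha>$k + ?w \<alpha> x 0 1 * \<beta>$k"
        unfolding all using d(1,2) by (simp add: algebra_simps)
      then show ?thesis using key[OF 1] by blast
    next
      case 2
      have "\<forall>k. ?w \<alpha> \<beta> 0 2 * x$k = ?w x \<beta> 0 2 * \<alpha>$k + ?w \<alpha> x 0 2 * \<beta>$k"
        unfolding all using d(1,3) by (simp add: algebra_simps)
      then show ?thesis using key[OF 2] by blast
    next
      case 3
      have "\<forall>k. ?w \<alpha> \<beta> 0 3 * x$k = ?w x \<beta> 0 3 * \<alpha>$k + ?w \<alpha> x 0 3 * \<beta>$k"
        unfolding all using d(2,3) by (simp add: algebra_simps)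
      then show ?thesis using key[OF 3] by blast
    next
      case 4
      have "\<forall>k. ?w \<alpha> \<beta> 1 2 * x$k = ?w x \<beta> 1 2 * \<alpha>$k + ?w \<alpha> x 1 2 * \<beta>$k"
        unfolding all using d(1,4) by (simp add: algebra_simps)
      then show ?thesis using key[OF 4] by blast
    next
      case 5
      have "\<forall>k. ?w \<alpha> \<beta> 1 3 * x$k = ?w x \<beta> 1 3 * \<alpha>$k + ?w \<alpha> x 1 3 * \<beta>$k"
        unfolding all using d(2,4) by (simp add: algebra_simps)
      then show ?thesis using key[OF 5] by blast
    next
      case 6
      have "\<forall>k. ?w \<alpha> \<beta> 2 3 * x$k = ?w x \<beta> 2 3 * \<alpha>$k + ?w \<alpha> x 2 3 * \<beta>$k"
        unfolding all using d(3,4) by (simp add: algebra_simps)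
      then show ?thesis using key[OF 6] by blast
    qed
  qed
qed

lemma has_pluecker_scale:
  assumes "has_pluecker l g" "c \<noteq> 0" shows "has_pluecker l (c *\<^sub>R g)"
proof -
  obtain \<alpha> \<beta> where "l = span {\<alpha>, \<beta>}" "g = pluecker \<alpha> \<beta>" "g \<noteq> 0"
    using assms by (auto simp: has_pluecker_iff)
  note g = this
  have sp: "span {c *\<^sub>R \<alpha>, \<beta>} = span {\<alpha>, \<beta>}"
  proof (rule span_eq[THEN iffD2], safe)
    have "c *\<^sub>R \<alpha> \<in> span {\<alpha>, \<beta>}" "\<beta> \<in> span {\<alpha>, \<beta>}"
      by (auto intro: span_base span_scale)
    then show "c *\<^sub>R \<alpha> \<in> span {\<alpha>, \<beta>}" "\<beta> \<in> span {\<alpha>, \<beta>}" by auto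
    have "inverse c *\<^sub>R (c *\<^sub>R \<alpha>) \<in> span {c *\<^sub>R \<alpha>, \<beta>}" by (intro span_scale span_base) auto
    then show "\<alpha> \<in> span {c *\<^sub>R \<alpha>, \<beta>}" using assms by simp
    show "\<beta> \<in> span {c *\<^sub>R \<alpha>, \<beta>}" by (auto intro: span_base)
  qed
  have pl: "pluecker (c *\<^sub>R \<alpha>) \<beta> = c *\<^sub>R pluecker \<alpha> \<beta>"
    by (simp add: pluecker_def algebra_simps)
  show ?thesis
    unfolding has_pluecker_iff
  proof (intro conjI exI)
    show "c *\<^sub>R g \<noteq> 0" using g(3) assms(2) by simp
    show "l = span {c *\<^sub>R \<alpha>, \<beta>}" using g(1) sp by (rule trans[OF _ sym])
    show "c *\<^sub>R g = pluecker (c *\<^sub>R \<alpha>) \<beta>" unfolding g(2) pl by (rule refl)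
  qed
qed

lemma has_pluecker_inj:
  assumes "has_pluecker l g" "has_pluecker l' g" shows "l = l'"
proof -
  obtain g01 g23 g02 g13 g03 g12 where g: "g = (g01, g23, g02, g13, g03, g12)" by (cases g)
  show ?thesis
    by (rule set_eqI)
      (simp only: mem_line_iff[OF assms(1)[unfolded g]] mem_line_iff[OF assms(2)[unfolded g]])
qed

lemma line_of_coords_eq:
  assumes "has_pluecker l g" shows "line_of_coords g = l"
  unfolding line_of_coords_def
proof (rule the_equality)
  show "has_pluecker l g" by (rule assms)
  show "l' = l" if "has_pluecker l' g" for l' using that assms by (rule has_pluecker_inj)
qed

lemma has_pluecker_unique:
  assumes "has_pluecker l g" "has_pluecker l h" shows "\<exists>c. c \<noteq> 0 \<and> h = c *\<^sub>R g"
proof -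
  obtain \<alpha> \<beta> where l: "l = span {\<alpha>, \<beta>}" "g = pluecker \<alpha> \<beta>" "g \<noteq> 0"
    using assms by (auto simp: has_pluecker_iff)
  obtain \<alpha>' \<beta>' where l': "l = span {\<alpha>', \<beta>'}" "h = pluecker \<alpha>' \<beta>'" "h \<noteq> 0"
    using assms by (auto simp: has_pluecker_iff)
  have "\<alpha>' \<in> span {\<alpha>, \<beta>}" "\<beta>' \<in> span {\<alpha>, \<beta>}"
    using l(1) l'(1) by (auto intro: span_base)
  then obtain s t s' t' where "\<alpha>' - s *\<^sub>R \<alpha> = t *\<^sub>R \<beta>" "\<beta>' - s' *\<^sub>R \<alpha> = t' *\<^sub>R \<beta>"
    unfolding span_insert span_singleton by auto
  then have "\<alpha>' = s *\<^sub>R \<alpha> + t *\<^sub>R \<beta>" "\<beta>' = s' *\<^sub>R \<alpha> + t' *\<^sub>R \<beta>" by (simp_all add: algebra_simps)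
  then have "h = (s * t' - t * s') *\<^sub>R g"
    by (simp add: l l' pluecker_def algebra_simps)
  with l' show ?thesis by (metis scaleR_zero_left)
qed

lemma vecof4: "\<exists>x::real^4. x$0 = a \<and> x$1 = b \<and> x$2 = c \<and> x$3 = d"
  by (rule exI[of _ "\<chi> i. if i = 0 then a else if i = 1 then b else if i = 2 then c else d"]) simp

lemma has_pluecker_ex_iff:
  "(\<exists>l. has_pluecker l (g01, g23, g02, g13, g03, g12)) \<longleftrightarrow>
   (g01, g23, g02, g13, g03, g12) \<noteq> 0 \<and> g01 * g23 - g02 * g13 + g03 * g12 = 0"
proof (intro iffI conjI; (elim exE conjE)?)
  fix l assume "has_pluecker l (g01, g23, g02, g13, g03, g12)"
  then show "(g01, g23, g02, g13, g03, g12) \<noteq> 0" by (auto simp: has_pluecker_iff)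
next
  fix l assume "has_pluecker l (g01, g23, g02, g13, g03, g12)"
  then show "g01 * g23 - g02 * g13 + g03 * g12 = 0"
    by (auto simp: has_pluecker_iff pluecker_def) (simp add: algebra_simps)
next
  assume nz: "(g01, g23, g02, g13, g03, g12) \<noteq> 0" and q: "g01 * g23 - g02 * g13 + g03 * g12 = 0"
  have "\<exists>\<alpha> \<beta> c. c \<noteq> 0 \<and> pluecker \<alpha> \<beta> = c *\<^sub>R (g01, g23, g02, g13, g03, g12)"
  proof -
    obtain r0 where r0: "r0$0 = 0" "r0$1 = g01" "r0$2 = g02" "(r0::real^4)$3 = g03" using vecof4 by blast
    obtain r1 where r1: "r1$0 = -g01" "r1$1 = 0" "r1$2 = g12" "(r1::real^4)$3 = g13" using vecof4 by blast
    obtain r2 where r2: "r2$0 = -g02" "r2$1 = -g12" "r2$2 = 0" "(r2::real^4)$3 = g23" using vecof4 by blast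
    obtain r3 where r3: "r3$0 = -g03" "r3$1 = -g13" "r3$2 = -g23" "(r3::real^4)$3 = 0" using vecof4 by blast
    have "pluecker r0 r1 = g01 *\<^sub>R (g01, g23, g02, g13, g03, g12)"
      "pluecker r0 r2 = g02 *\<^sub>R (g01, g23, g02, g13, g03, g12)"
      "pluecker r0 r3 = g03 *\<^sub>R (g01, g23, g02, g13, g03, g12)"
      "pluecker r1 r2 = g12 *\<^sub>R (g01, g23, g02, g13, g03, g12)"
      "pluecker r1 r3 = g13 *\<^sub>R (g01, g23, g02, g13, g03, g12)"
      "pluecker r2 r3 = g23 *\<^sub>R (g01, g23, g02, g13, g03, g12)"
      using q by (simp_all add: pluecker_def r0 r1 r2 r3) algebra+
    then show ?thesis using nz by (auto simp: zero_prod_def)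
  qed
  then obtain \<alpha> \<beta> c where c: "c \<noteq> 0" "pluecker \<alpha> \<beta> = c *\<^sub>R (g01, g23, g02, g13, g03, g12)" by blast
  then have "has_pluecker (span {\<alpha>, \<beta>}) (c *\<^sub>R (g01, g23, g02, g13, g03, g12))"
    unfolding has_pluecker_iff using nz by (metis scaleR_eq_0_iff)
  from has_pluecker_scale[OF this, of "inverse c"] c
  show "\<exists>l. has_pluecker l (g01, g23, g02, g13, g03, g12)" by (auto simp del: scaleR_Pair)
qed


lemma circle_of_line_eq:
  assumes T: "lie_isometry T" and l: "has_pluecker l (g01, g23, g02, g13, g03, g03)"
  shows "circle_of_line T l = span {T (g01, g23, g02, g13, g03)}"
proof -
  have lin: "linear T" using T by (simp add: lie_isometry_def)
  have "{T (h01, h23, h02, h13, h03) | h01 h23 h02 h13 h03.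
     has_pluecker l (h01, h23, h02, h13, h03, h03)} \<subseteq> span {T (g01, g23, g02, g13, g03)}"
  proof
    fix V assume "V \<in> {T (h01, h23, h02, h13, h03) | h01 h23 h02 h13 h03.
      has_pluecker l (h01, h23, h02, h13, h03, h03)}"
    then obtain h01 h23 h02 h13 h03 where V: "V = T (h01, h23, h02, h13, h03)"
      and h: "has_pluecker l (h01, h23, h02, h13, h03, h03)" by blast
    from has_pluecker_unique[OF l h] obtain c
      where "(h01, h23, h02, h13, h03) = c *\<^sub>R (g01, g23, g02, g13, g03)" by auto
    then have "T (h01, h23, h02, h13, h03) = c *\<^sub>R T (g01, g23, g02, g13, g03)"
      by (simp only: linear_cmul[OF lin])
    then show "V \<in> span {T (g01, g23, g02, g13, g03)}"
      unfolding V by (simp only: span_scale span_base insertI1)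
  qed
  moreover have mem: "T (g01, g23, g02, g13, g03) \<in> {T (h01, h23, h02, h13, h03) | h01 h23 h02 h13 h03.
     has_pluecker l (h01, h23, h02, h13, h03, h03)}"
    unfolding mem_Collect_eq by (intro exI conjI, rule refl, rule l)
  ultimately show ?thesis
    unfolding circle_of_line_def
    by (intro subset_antisym span_minimal subspace_span) (simp_all only: insert_subset empty_subsetI span_base)
qed

lemma bij_circle_of_line:
  assumes T: "lie_isometry T"
  shows "bij_betw (circle_of_line T) linear_complex oriented_circles"
proof -
  have lin: "linear T" and bij: "bij T"
    and iso: "\<And>g h. lie_form (T g) (T h) = complex_form g h"
    using T by (auto simp: lie_isometry_def)
  have T0: "T g = 0 \<longleftrightarrow> g = 0" for g
    using linear_0[OF lin] bij by (metis bij_is_inj injD)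
  have lie_scale: "lie_form (c *\<^sub>R V) (c *\<^sub>R V) = c^2 * lie_form V V" for c V
    by (cases V) (simp add: power2_eq_square algebra_simps)
  show ?thesis
    unfolding bij_betw_def
    proof
      show "inj_on (circle_of_line T) linear_complex"
      proof (rule inj_onI)
        fix l l' assume "l \<in> linear_complex" "l' \<in> linear_complex"
          and eq: "circle_of_line T l = circle_of_line T l'"
        then obtain a b c d e a' b' c' d' e'
          where l: "has_pluecker l (a,b,c,d,e,e)" and l': "has_pluecker l' (a',b',c',d',e',e')"
          unfolding linear_complex_def by blast
        have "T (a',b',c',d',e') \<in> span {T (a,b,c,d,e)}"
          using eq unfolding circle_of_line_eq[OF T l] circle_of_line_eq[OF T l']
          by (auto intro: span_base)
        then obtain k where "T (a',b',c',d',e') = T (k *\<^sub>R (a,b,c,d,e))"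
          unfolding span_singleton linear_cmul[OF lin] by auto
        then have k: "(a',b',c',d',e') = k *\<^sub>R (a,b,c,d,e)" using bij by (meson bij_is_inj injD)
        moreover have "k \<noteq> 0"
        proof
          assume "k = 0" with k l' show False by (auto simp: has_pluecker_iff zero_prod_def)
        qed
        ultimately have "has_pluecker l (a',b',c',d',e',e')"
          using has_pluecker_scale[OF l, of k] by simp
        then show "l = l'" using l' has_pluecker_inj by blast
      qed
    next
      show "circle_of_line T ` linear_complex = oriented_circles"
      proof
        show "circle_of_line T ` linear_complex \<subseteq> oriented_circles"
        proof
          fix C assume "C \<in> circle_of_line T ` linear_complex"
          then obtain l a b c d e where l: "has_pluecker l (a,b,c,d,e,e)" and C: "C = circle_of_line T l"
            unfolding linear_complex_def by blast
          have "(a,b,c,d,e,e) \<noteq> 0" "a * b - c * d + e * e = 0" using has_pluecker_ex_iff l by blast+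
          then have "T (a,b,c,d,e) \<noteq> 0" "lie_form (T (a,b,c,d,e)) (T (a,b,c,d,e)) = 0"
            unfolding T0 iso by (auto simp: zero_prod_def)
          then show "C \<in> oriented_circles"
            unfolding C circle_of_line_eq[OF T l] oriented_circles_def
            by (auto simp: dim_eq_card_independent lie_scale dest!: span_singleton[THEN equalityD1, THEN subsetD])
        qed
      next
        show "oriented_circles \<subseteq> circle_of_line T ` linear_complex"
        proof
          fix C assume C: "C \<in> oriented_circles"
          then obtain B where B: "B \<subseteq> C" "independent B" "C \<subseteq> span B" "card B = 1"
            unfolding oriented_circles_def using basis_exists by (metis (mono_tags, lifting) mem_Collect_eq)
          then obtain V where "B = {V}" by (auto simp: card_1_singleton_iff)
          with B C have V: "V \<noteq> 0" "lie_form V V = 0"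
            unfolding oriented_circles_def by auto
          have CV: "C = span {V}"
            using B C \<open>B = {V}\<close> unfolding oriented_circles_def
            by (intro subset_antisym span_minimal) auto
          obtain a b c d e where g: "V = T (a,b,c,d,e)" using bij by (metis bij_pointE prod_cases5)
          have "(a,b,c,d,e,e) \<noteq> 0" "a * b - c * d + e * e = 0"
            using V unfolding g T0 iso by (auto simp: zero_prod_def)
          then obtain l where l: "has_pluecker l (a,b,c,d,e,e)" using has_pluecker_ex_iff by blast
          then have "l \<in> linear_complex" unfolding linear_complex_def by blast
          moreover have "C = circle_of_line T l" using CV g circle_of_line_eq[OF T l] by simp
          ultimately show "C \<in> circle_of_line T ` linear_complex" by blast
        qed
      qed
    qed
  qed

lemma lie_isometry_exists: "\<exists>T. lie_isometry T"
proof -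
  define T :: "real5 \<Rightarrow> real5" where
    "T = (\<lambda>(a,b,c,d,e). (sqrt 2 * e, d / 2 - c, a, - 2 * b, d / 2 + c))"
  define S :: "real5 \<Rightarrow> real5" where
    "S = (\<lambda>(x,y,a,b,r). (a, - b / 2, (r - y) / 2, r + y, x / sqrt 2))"
  have "linear T" by (rule linearI) (auto simp: T_def field_simps)
  moreover have "bij T"
    by (rule o_bij[of S]) (auto simp: fun_eq_iff S_def T_def field_simps)
  moreover have "lie_form (T g) (T h) = complex_form g h" for g h
    by (cases g; cases h) (auto simp: T_def field_simps)
  ultimately show ?thesis unfolding lie_isometry_def by blast
qed

lemma has_M_coords: "has_pluecker (line_of_coords (M_coords A)) (M_coords A)"
proof -
  have "\<exists>l. has_pluecker l (M_coords A)"
    unfolding M_coords_def has_pluecker_ex_iff by (simp add: zero_prod_def algebra_simps)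
  then show ?thesis using line_of_coords_eq by metis
qed

end

theory Submission
  imports Defs
begin

text \<open>
  The intersection of neighbouring lines is cut out of the line at \<open>n\<close> by the condition
  that \<open>(x$0, x$1)\<close> is proportional to the row \<open>(M\<^sup>l\<^sup>4, M\<^sup>l\<^sup>5)\<close>.  Coplanarity of the four
  points \<open>p\<^sup>l\<close> is witnessed by a linear form that is unchanged by the shifts \<open>m\<close> and \<open>p\<close> and
  vanishes on \<open>p\<^sup>l\<close> at each site.

  If all lines lie in the linear complex, then \<open>M\<^sup>4\<^sup>5 = M\<^sup>5\<^sup>4\<close> at neighbouring sites forces
  \<open>(M\<^sup>4\<^sup>l, M\<^sup>5\<^sup>l) = \<rho>\<^sup>l (M\<^sup>l\<^sup>4, M\<^sup>l\<^sup>5)\<close>.  Comparing this relation at \<open>n\<close> and at the site shifted in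
  direction \<open>m\<close>, and using that \<open>p\<^sup>l \<noteq> p\<^sup>m\<close>, gives both \<open>\<rho>\<^sup>l\<^sub>m = \<rho>\<^sup>l\<close> and \<open>\<rho>\<^sup>l M\<^sup>l\<^sup>m = \<rho>\<^sup>m M\<^sup>m\<^sup>l\<close>.  Hence
  rescaling row \<open>l\<close> by \<open>\<rho>\<^sup>l\<close> preserves the \<open>M\<close>-system and makes the solution symmetric.
\<close>

section \<open>Matrix indices, the lines as graphs, and invariant planes\<close>

lemma dir_neq [simp]: "dir l \<noteq> 4" "dir l \<noteq> 5" "4 \<noteq> dir l" "5 \<noteq> dir l"
  by (auto simp: dir_def)

lemma dir_eq_iff [simp]: "dir l = dir m \<longleftrightarrow> l = m"
  using exhaust_3[of l] exhaust_3[of m] by (auto simp: dir_def)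

lemma five_cases:
  fixes i :: 5
  obtains l where "i = dir l" | "i = 4" | "i = 5"
proof -
  have "i = dir 1 \<or> i = dir 2 \<or> i = dir 3 \<or> i = 4 \<or> i = 5"
  proof (induct i)
    case (of_int z)
    \<comment> \<open>The residue 0 stands for the index 5.\<close>
    then have "z = 0 \<or> z = 1 \<or> z = 2 \<or> z = 3 \<or> z = 4" by (simp; presburger)
    then show ?case by (auto simp: dir_def)
  qed
  then show thesis using that by blast
qed

lemma M_system_shift:
  assumes "M_system M" "i \<noteq> dir l" "k \<noteq> dir l"
  shows "M (shift l n) $ i $ k =
    M n $ i $ k - M n $ i $ dir l * M n $ dir l $ k / M n $ dir l $ dir l"
  using assms unfolding M_system_def by auto

text \<open>As the first coordinate is 1, the line is a graph over \<open>(x$0, x$1)\<close>; the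
  other two incidence equations follow from these because \<open>23\<close> is the determinant of
  the lower block.\<close>

lemma mem_M_line_iff:
  assumes "has_pluecker l (M_coords A)"
  shows "x \<in> l \<longleftrightarrow>
    x$2 = A$4$4 * x$1 - A$4$5 * x$0 \<and> x$3 = A$5$4 * x$1 - A$5$5 * x$0"
  unfolding mem_line_iff[OF assms[unfolded M_coords_def]]
  by (auto simp: algebra_simps) algebra+

lemma M_line_eqI:
  assumes "has_pluecker l (M_coords A)" "has_pluecker l' (M_coords B)"
    "A$4$4 = B$4$4" "A$4$5 = B$4$5" "A$5$4 = B$5$4" "A$5$5 = B$5$5"
  shows "l = l'"
  using assms has_pluecker_inj unfolding M_coords_def by auto

lemma zero_or_parallel:
  fixes a b c d :: real
  assumes "a * d = b * c" "a \<noteq> 0 \<or> b \<noteq> 0" "c \<noteq> 0 \<or> d \<noteq> 0"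
  obtains r where "r \<noteq> 0" "c = r * a" "d = r * b"
proof (cases "a = 0")
  case True
  then show ?thesis using assms that[of "d / b"] by auto
next
  case False
  then have "c \<noteq> 0" using assms by auto
  then show ?thesis using assms False that[of "c / a"] by (auto simp: field_simps)
qed

text \<open>
  With \<open>i = dir l\<close> these linear forms vanish on \<open>p\<^sup>l\<close> for every \<open>\<theta>\<close>; the choice of \<open>\<theta>\<close> is
  used to make them invariant under the other two shifts.
\<close>

definition plane_form :: "real^5^5 \<Rightarrow> 5 \<Rightarrow> real \<times> real \<times> real \<Rightarrow> real^4 \<Rightarrow> real" where
  "plane_form A i \<theta> x = (case \<theta> of (s, a, b) \<Rightarrow>
     s * (A$i$5 * x$0 - A$i$4 * x$1) +
     a * (x$2 - A$4$4 * x$1 + A$4$5 * x$0) + b * (x$3 - A$5$4 * x$1 + A$5$5 * x$0))"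

text \<open>A shift in direction \<open>m\<close> subtracts a rank-one matrix, so the change of the
  form factors into the inner product in the assumption and a linear form in \<open>x$0\<close> and
  \<open>x$1\<close>.\<close>

lemma plane_form_shift:
  assumes "M_system M" "i \<noteq> dir m"
    "\<theta> \<bullet> (M n $ i $ dir m, M n $ 4 $ dir m, M n $ 5 $ dir m) = 0"
  shows "plane_form (M (shift m n)) i \<theta> x = plane_form (M n) i \<theta> x"
proof -
  obtain s a b where \<theta>: "\<theta> = (s, a, b)" by (cases \<theta>)
  let ?A = "M n" and ?m = "dir m"
  have "plane_form (M (shift m n)) i \<theta> x = plane_form ?A i \<theta> x -
    (s * ?A$i$?m + a * ?A$4$?m + b * ?A$5$?m) *
    (?A$?m$5 * x$0 - ?A$?m$4 * x$1) / ?A$?m$?m"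
    unfolding plane_form_def \<theta> using assms(2)
    by (simp add: M_system_shift[OF assms(1)] ring_distribs add_divide_distrib diff_divide_distrib algebra_simps)
  then show ?thesis using assms(3) by (simp add: \<theta>)
qed

text \<open>\<open>a\<close> and \<open>b\<close> survive as the coefficients of \<open>x$2\<close>
  and \<open>x$3\<close>; if both vanish, then \<open>s\<close> does not, and row \<open>i\<close>
  supplies a nonzero coefficient.\<close>

lemma dim_plane_form:
  assumes "\<theta> \<noteq> 0" "A$i$4 \<noteq> 0 \<or> A$i$5 \<noteq> 0"
  shows "subspace {x. plane_form A i \<theta> x = 0}" "dim {x. plane_form A i \<theta> x = 0} = 3"
proof -
  obtain s a b where \<theta>: "\<theta> = (s, a, b)" by (cases \<theta>)
  obtain w :: "real^4" where w: "w$0 = s * A$i$5 + a * A$4$5 + b * A$5$5"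
    "w$1 = - s * A$i$4 - a * A$4$4 - b * A$5$4" "w$2 = a" "w$3 = b"
    using vecof4 by blast
  have four: "(4::4) = 0" by simp
  have "plane_form A i \<theta> x = w \<bullet> x" for x
    unfolding plane_form_def \<theta> inner_vec_def sum_4 four by (simp add: w algebra_simps)
  then have eq: "{x. plane_form A i \<theta> x = 0} = {x. w \<bullet> x = 0}" by auto
  have "w \<noteq> 0"
  proof
    assume "w = 0"
    then have "a = 0" "b = 0" "s * A$i$5 = 0" "s * A$i$4 = 0" using w by auto
    then show False using assms \<theta> by (auto simp: zero_prod_def)
  qed
  then show "subspace {x. plane_form A i \<theta> x = 0}" "dim {x. plane_form A i \<theta> x = 0} = 3"
    unfolding eq by (simp_all add: subspace_hyperplane dim_hyperplane)
qed

lemma ex_orthogonal_two: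
  fixes u v :: "real \<times> real \<times> real"
  obtains w where "w \<noteq> 0" "w \<bullet> u = 0" "w \<bullet> v = 0"
proof -
  have "dim {u, v} \<le> card {u, v}" by (rule dim_le_card) (auto intro: span_base)
  also have "\<dots> \<le> 2" by (simp add: card_insert_if)
  finally have "dim {u, v} < DIM(real \<times> real \<times> real)" by simp
  from orthogonal_to_subspace_exists[OF this] obtain w
    where "w \<noteq> 0" "\<And>y. y \<in> span {u, v} \<Longrightarrow> orthogonal w y" by blast
  then show thesis using that[of w] by (auto simp: orthogonal_def span_base)
qed

section \<open>Intersection points and their coplanarity\<close>

locale M_line_complex =
  fixes M :: "int^3 \<Rightarrow> real^5^5" and L :: "int^3 \<Rightarrow> (real^4) set"
  assumes M_system: "M_system M"
    and pivots: "nonzero_pivots M"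
    and plk: "has_pluecker (L n) (M_coords (M n))"
    and nondegenerate: "nondegenerate L"
begin

text \<open>If the row or the column vanished, the shift \<open>l\<close> would leave the lower 2x2
  block unchanged and neighbouring lines would coincide.\<close>

lemma row_col_nonzero:
  shows "M n $ dir l $ 4 \<noteq> 0 \<or> M n $ dir l $ 5 \<noteq> 0"
    and "M n $ 4 $ dir l \<noteq> 0 \<or> M n $ 5 $ dir l \<noteq> 0"
proof -
  have ne: "L n \<noteq> L (shift l n)" using nondegenerate unfolding nondegenerate_def by blast
  show "M n $ dir l $ 4 \<noteq> 0 \<or> M n $ dir l $ 5 \<noteq> 0"
    using ne M_line_eqI[OF plk plk, of n "shift l n"] by (auto simp: M_system_shift[OF M_system])
  show "M n $ 4 $ dir l \<noteq> 0 \<or> M n $ 5 $ dir l \<noteq> 0"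
    using ne M_line_eqI[OF plk plk, of n "shift l n"] by (auto simp: M_system_shift[OF M_system])
qed

text \<open>The equations of the two neighbouring lines differ by a multiple of the column
  \<open>(?A$4$?l, ?A$5$?l)\<close>, which is nonzero, so the factor \<open>?D\<close> must
  vanish.\<close>

lemma mem_focal_point_iff:
  "x \<in> focal_point L l n \<longleftrightarrow> x \<in> L n \<and> M n $ dir l $ 5 * x$0 = M n $ dir l $ 4 * x$1"
proof -
  let ?A = "M n" and ?l = "dir l"
  let ?D = "?A$?l$5 * x$0 - ?A$?l$4 * x$1"
  have piv: "?A$?l$?l \<noteq> 0" using pivots unfolding nonzero_pivots_def by blast
  have "x \<in> L (shift l n) \<longleftrightarrow>
    x$2 = ?A$4$4 * x$1 - ?A$4$5 * x$0 + ?A$4$?l * ?D / ?A$?l$?l \<and>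
    x$3 = ?A$5$4 * x$1 - ?A$5$5 * x$0 + ?A$5$?l * ?D / ?A$?l$?l"
    unfolding mem_M_line_iff[OF plk]
    by (simp add: M_system_shift[OF M_system] algebra_simps diff_divide_distrib)
  then have "x \<in> L n \<and> x \<in> L (shift l n) \<longleftrightarrow> x \<in> L n \<and> ?A$4$?l * ?D = 0 \<and> ?A$5$?l * ?D = 0"
    unfolding mem_M_line_iff[OF plk] using piv by auto
  then show ?thesis using row_col_nonzero(2)[of n l] unfolding focal_point_def by auto
qed

lemma focal_point_in_proj_points: "focal_point L l n \<in> proj_points"
proof -
  let ?A = "M n" and ?l = "dir l"
  \<comment> \<open>\<open>v\<close> is the point of \<open>L n\<close> lying over the row
    \<open>(?A$?l$4, ?A$?l$5)\<close>.\<close>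
  obtain v :: "real^4" where v: "v$0 = ?A$?l$4" "v$1 = ?A$?l$5"
    "v$2 = ?A$4$4 * ?A$?l$5 - ?A$4$5 * ?A$?l$4" "v$3 = ?A$5$4 * ?A$?l$5 - ?A$5$5 * ?A$?l$4"
    using vecof4 by blast
  have nz: "?A$?l$4 \<noteq> 0 \<or> ?A$?l$5 \<noteq> 0" by (rule row_col_nonzero)
  then have "v \<noteq> 0" using v by auto
  have "x \<in> focal_point L l n \<longleftrightarrow> x \<in> span {v}" for x
  proof
    assume x: "x \<in> focal_point L l n"
    have "\<exists>k. x$0 = k * ?A$?l$4 \<and> x$1 = k * ?A$?l$5"
    proof (cases "?A$?l$4 = 0")
      case True
      then show ?thesis using nz x unfolding mem_focal_point_iff
        by (intro exI[of _ "x$1 / ?A$?l$5"]) auto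
    next
      case False
      then show ?thesis using x unfolding mem_focal_point_iff
        by (intro exI[of _ "x$0 / ?A$?l$4"]) (auto simp: field_simps)
    qed
    then obtain k where "x$0 = k * ?A$?l$4" "x$1 = k * ?A$?l$5" by blast
    then have "x = k *\<^sub>R v"
      using x unfolding mem_focal_point_iff mem_M_line_iff[OF plk]
      by (simp add: vec4_eq_iff v algebra_simps)
    then show "x \<in> span {v}" unfolding span_singleton by blast
  next
    assume "x \<in> span {v}"
    then obtain k where "x = k *\<^sub>R v" unfolding span_singleton by blast
    then show "x \<in> focal_point L l n"
      unfolding mem_focal_point_iff mem_M_line_iff[OF plk] by (simp add: v algebra_simps)
  qed
  then have "focal_point L l n = span {v}" by blast
  with \<open>v \<noteq> 0\<close> show ?thesis by (simp add: proj_points_def dim_eq_card_independent)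
qed

lemma coplanar_focal_points:
  assumes "distinct [l, m, p]"
  shows "coplanar_points {focal_point L l n, focal_point L l (shift m n),
    focal_point L l (shift p (shift m n)), focal_point L l (shift p n)}"
proof -
  let ?col = "\<lambda>n k. (M n $ dir l $ dir k, M n $ 4 $ dir k, M n $ 5 $ dir k)"
  obtain \<theta> where \<theta>: "\<theta> \<noteq> 0" "\<theta> \<bullet> ?col n m = 0" "\<theta> \<bullet> ?col n p = 0"
    by (rule ex_orthogonal_two)
  \<comment> \<open>The shifted column is a combination of the two columns orthogonal to \<theta>,
    so the form also survives the second shift.\<close>
  have "?col (shift m n) p = ?col n p - (M n $ dir m $ dir p / M n $ dir m $ dir m) *\<^sub>R ?col n m"
    using assms by (auto simp: M_system_shift[OF M_system] mult.commute)
  then have "\<theta> \<bullet> ?col (shift m n) p = 0" using \<theta> by (simp only: inner_diff_right inner_scaleR_right)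
  then have "plane_form (M n') (dir l) \<theta> = plane_form (M n) (dir l) \<theta>"
    if "n' \<in> {n, shift m n, shift p (shift m n), shift p n}" for n'
    using that \<theta> assms by (auto simp: fun_eq_iff plane_form_shift[OF M_system] simp del: inner_Pair)
  moreover have "plane_form (M n') (dir l) \<theta> x = 0" if "x \<in> focal_point L l n'" for n' x
    using that unfolding mem_focal_point_iff mem_M_line_iff[OF plk]
    by (auto simp: plane_form_def split: prod.split)
  ultimately have "focal_point L l n' \<subseteq> {x. plane_form (M n) (dir l) \<theta> x = 0}"
    if "n' \<in> {n, shift m n, shift p (shift m n), shift p n}" for n'
    using that by (metis (mono_tags, lifting) mem_Collect_eq subsetI)
  then show ?thesis
    unfolding coplanar_points_def
    using dim_plane_form[OF \<theta>(1) row_col_nonzero(1)[of n l]] by blast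
qed

lemma fundamental: "fundamental_line_complex L"
  unfolding fundamental_line_complex_def
  using plk focal_point_in_proj_points coplanar_focal_points
  by (auto simp: has_pluecker_def)

section \<open>Symmetrization by rescaling rows\<close>

lemma rows_independent:
  assumes "l \<noteq> m"
  shows "M n $ dir l $ 4 * M n $ dir m $ 5 \<noteq> M n $ dir l $ 5 * M n $ dir m $ 4"
proof
  assume "M n $ dir l $ 4 * M n $ dir m $ 5 = M n $ dir l $ 5 * M n $ dir m $ 4"
  from zero_or_parallel[OF this row_col_nonzero(1) row_col_nonzero(1)] obtain r
    where "r \<noteq> 0" "M n $ dir m $ 4 = r * M n $ dir l $ 4" "M n $ dir m $ 5 = r * M n $ dir l $ 5" .
  \<comment> \<open>Parallel rows cut the same point out of \<open>L n\<close>.\<close>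
  then have "focal_point L l n = focal_point L m n"
    by (intro set_eqI) (simp add: mem_focal_point_iff)
  then show False using nondegenerate assms unfolding nondegenerate_def by blast
qed

lemma symmetrizable:
  assumes sym: "\<And>n. M n $ 4 $ 5 = M n $ 5 $ 4"
  obtains M' where "M_system M'" "nonzero_pivots M'" "\<And>n. transpose (M' n) = M' n"
    "\<And>n. M_coords (M' n) = M_coords (M n)"
proof -
  have piv: "M n $ dir l $ dir l \<noteq> 0" for n l
    using pivots unfolding nonzero_pivots_def by blast
  have "\<exists>r. r \<noteq> 0 \<and> M n $ 4 $ dir l = r * M n $ dir l $ 4 \<and> M n $ 5 $ dir l = r * M n $ dir l $ 5"
    for n l
  proof -
    \<comment> \<open>Symmetry at \<open>n\<close> and at \<open>shift l n\<close> makes the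
      subtracted rank-one term symmetric.\<close>
    have "M n $ dir l $ 4 * M n $ 5 $ dir l = M n $ dir l $ 5 * M n $ 4 $ dir l"
      using sym[of n] sym[of "shift l n"] piv[of n l]
      by (simp add: M_system_shift[OF M_system] mult.commute)
    from zero_or_parallel[OF this row_col_nonzero] show ?thesis by metis
  qed
  then obtain \<rho> where \<rho>_nz: "\<And>n l. \<rho> n l \<noteq> 0"
    and \<rho>: "\<And>n l. M n $ 4 $ dir l = \<rho> n l * M n $ dir l $ 4"
      "\<And>n l. M n $ 5 $ dir l = \<rho> n l * M n $ dir l $ 5"
    by metis
  have key: "\<rho> (shift m n) l = \<rho> n l \<and>
      \<rho> n l * M n $ dir l $ dir m = \<rho> n m * M n $ dir m $ dir l" if "l \<noteq> m" for l m n
  proof -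
    let ?A = "M n" and ?l = "dir l" and ?m = "dir m" and ?r = "\<rho> (shift m n) l"
    \<comment> \<open>\<open>c\<close> is the coefficient of row \<open>m\<close> left over when the
      relation for row \<open>l\<close> at the shifted site is written out at \<open>n\<close>;
      independence of the rows forces \<open>c = 0\<close>.\<close>
    define c where "c = (?r * ?A$?l$?m - \<rho> n m * ?A$?m$?l) / ?A$?m$?m"
    have "(?r - \<rho> n l) * ?A$?l$4 = c * ?A$?m$4" "(?r - \<rho> n l) * ?A$?l$5 = c * ?A$?m$5"
      using \<rho>(1)[of "shift m n" l] \<rho>(2)[of "shift m n" l] that piv[of n m]
      by (simp_all add: M_system_shift[OF M_system] \<rho>(1)[of n] \<rho>(2)[of n] c_def field_simps)
    then have "(?r - \<rho> n l) * (?A$?l$4 * ?A$?m$5 - ?A$?l$5 * ?A$?m$4) = 0"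
      "c * (?A$?l$4 * ?A$?m$5 - ?A$?l$5 * ?A$?m$4) = 0" by algebra+
    then have "?r = \<rho> n l" "c = 0" using rows_independent[OF that, of n] by auto
    then show ?thesis using piv[of n m] by (auto simp: c_def)
  qed
  \<comment> \<open>The factor 1 at the indices 4 and 5 keeps the coordinates of the lines.\<close>
  define s where "s n i = (if i = 4 \<or> i = 5 then 1 else \<rho> n (inv dir i))" for n i
  have s[simp]: "s n 4 = 1" "s n 5 = 1" "s n (dir l) = \<rho> n l" for n l
    by (auto simp: s_def inv_f_f inj_def)
  define M' where "M' n = (\<chi> i k. s n i * M n $ i $ k)" for n
  show thesis
  proof
    show "M_system M'"
      unfolding M_system_def
    proof (intro allI impI)
      fix n l i k assume "dir l \<notin> {i, k}"
      then have "i \<noteq> dir l" "k \<noteq> dir l" by auto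
      \<comment> \<open>A row factor can vary only along its own direction, and
        \<open>i \<noteq> dir l\<close> excludes that case; the factor of row \<open>l\<close>
        cancels in the quotient.\<close>
      moreover have "s (shift l n) i = s n i"
        using \<open>i \<noteq> dir l\<close> key by (cases i rule: five_cases) auto
      ultimately show "M' (shift l n) $ i $ k =
          M' n $ i $ k - M' n $ i $ dir l * M' n $ dir l $ k / M' n $ dir l $ dir l"
        using \<rho>_nz by (simp add: M'_def M_system_shift[OF M_system] algebra_simps)
    qed
    show "nonzero_pivots M'"
      using piv \<rho>_nz by (simp add: nonzero_pivots_def M'_def)
    show "transpose (M' n) = M' n" for n
    proof -
      have "s n k * M n $ k $ i = s n i * M n $ i $ k" for i k
        using key sym \<rho> by (cases i rule: five_cases; cases k rule: five_cases) (auto, metis)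
      then show ?thesis by (simp add: vec_eq_iff transpose_def M'_def)
    qed
    show "M_coords (M' n) = M_coords (M n)" for n
      by (simp add: M_coords_def M'_def)
  qed
qed

end

section \<open>Passage between lines and circles\<close>

theorem theorem4p2:
  fixes T :: "real5 \<Rightarrow> real5"
  assumes "lie_isometry T"
  shows
    "(\<forall>M :: int^3 \<Rightarrow> real^5^5.
        generic_solution M \<and> (\<forall>n. transpose (M n) = M n) \<longrightarrow>
        (\<forall>n. has_pluecker (M_lines M n) (M_coords (M n)) \<and> M_lines M n \<in> linear_complex) \<and>
        fundamental_circle_complex T (\<lambda>n. circle_of_line T (M_lines M n)))
     \<and>
     (\<forall>c :: int^3 \<Rightarrow> real5 set.
        fundamental_circle_complex T c \<and> generic_circle_complex T c \<longrightarrow>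
        (\<exists>M :: int^3 \<Rightarrow> real^5^5.
           generic_solution M \<and> (\<forall>n. transpose (M n) = M n) \<and>
           (\<forall>n. c n = circle_of_line T (M_lines M n))))"
proof (intro conjI allI impI; (elim conjE)?)
  note bij = bij_circle_of_line[OF assms]
  {
    fix M :: "int^3 \<Rightarrow> real^5^5"
    assume M: "generic_solution M" and sym: "\<forall>n. transpose (M n) = M n"
    have plk: "has_pluecker (M_lines M n) (M_coords (M n))" for n
      unfolding M_lines_def by (rule has_M_coords)
    then show "has_pluecker (M_lines M n) (M_coords (M n))" for n .
    have "M n $ 5 $ 4 = M n $ 4 $ 5" for n
      using arg_cong[OF spec[OF sym], of "\<lambda>A. A $ 4 $ 5" n] by (simp add: transpose_def)
    then show lin: "M_lines M n \<in> linear_complex" for n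
      using plk[of n] unfolding linear_complex_def M_coords_def by blast
    interpret M_line_complex M "M_lines M"
      using M plk unfolding generic_solution_def by unfold_locales auto
    have "line_of_circle T (circle_of_line T (M_lines M n)) = M_lines M n" for n
      unfolding line_of_circle_def using bij lin by (simp add: bij_betw_def the_inv_into_f_f)
    then show "fundamental_circle_complex T (\<lambda>n. circle_of_line T (M_lines M n))"
      unfolding fundamental_circle_complex_def
      using fundamental bij lin by (auto simp: bij_betw_def)
  }
  fix c :: "int^3 \<Rightarrow> real5 set"
  assume c: "fundamental_circle_complex T c" and gen: "generic_circle_complex T c"
  define L where "L n = line_of_circle T (c n)" for n
  have circ: "c n \<in> oriented_circles" for n using c unfolding fundamental_circle_complex_def by blast
  have lin: "L n \<in> linear_complex" for n
    unfolding L_def line_of_circle_def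
    using bij circ by (metis bij_betwE bij_betw_the_inv_into)
  have c_eq: "c n = circle_of_line T (L n)" for n
    unfolding L_def line_of_circle_def
    using f_the_inv_into_f_bij_betw[OF bij] circ by metis
  obtain M where M: "M_system M" "nonzero_pivots M" and plk: "\<And>n. has_pluecker (L n) (M_coords (M n))"
    and nd: "nondegenerate L"
    using gen unfolding generic_circle_complex_def generic_line_complex_def L_def by blast
  interpret M_line_complex M L using M plk nd by unfold_locales
  have "M n $ 4 $ 5 = M n $ 5 $ 4" for n
  proof -
    obtain a b d e f where g: "has_pluecker (L n) (a, b, d, e, f, f)"
      using lin[of n] unfolding linear_complex_def by blast
    \<comment> \<open>Equality of the last two coordinates is preserved by rescaling.\<close>
    from has_pluecker_unique[OF g plk] show ?thesis unfolding M_coords_def by auto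
  qed
  from symmetrizable[OF this] obtain M' where M': "M_system M'" "nonzero_pivots M'"
    "\<And>n. transpose (M' n) = M' n" "\<And>n. M_coords (M' n) = M_coords (M n)" by metis
  \<comment> \<open>The lines are unchanged, so the symmetric solution inherits
    nondegeneracy.\<close>
  have "M_lines M' = L" unfolding M_lines_def M'(4) using line_of_coords_eq[OF plk] by blast
  then show "\<exists>M. generic_solution M \<and> (\<forall>n. transpose (M n) = M n) \<and>
      (\<forall>n. c n = circle_of_line T (M_lines M n))"
    using M' nd c_eq unfolding generic_solution_def by metis
qed

end
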